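(* Let $J$ and $f$ satisfy the standing assumptions in the context, and let $\mu_0$ be the generalized principal eigenvalue defined there. The stationary equation $$J*u-u+f(x,u)=0\qquad (x\in\mathbb{R}^N)$$ has a positive continuous $[0,1]^N$-periodic solution $p$ if and only if $\mu_0<0$. Moreover, the positive solution is Lipschitz continuous and is unique in the class of positive bounded periodic functions.
   Context: Standing assumptions. $J:\mathbb{R}^N\to\mathbb{R}$ is smooth, $J\ge 0$, $\int_{\mathbb{R}^N}J=1$, $J(0)>0$, $J$ is symmetric ($J(-x)=J(x)$) and its support is contained in the unit ball. $f:\mathbb{R}^N\times[0,\infty)\to\mathbb{R}$ is $[0,1]^N$-periodic in $x$ (i.e. $f(x+k,u)=f(x,u)$ for $k\in\mathbb{Z}^N$), $f\in C^3(\mathbb{R}^N\times[0,\infty))$, $f(\cdot,0)\equiv0$, $u\mapsto f(x,u)/u$ is decreasing on $(0,+\infty)$, and there is $M>0$ with $f(x,u)\le0$ for all $u\ge M$ and all $x$. $C_{per}(\mathbb{R}^N)$ is the space of continuous $[0,1]^N$-periodic functions on $\mathbb{R}^N$, $*$ is convolution on $\mathbb{R}^N$, $f_u=\partial f/\partial u$, and $$\mu_0=\sup\{\mu\in\mathbb{R}\mid \exists\,\phi\in C_{per}(\mathbb{R}^N),\ \phi>0,\ J*\phi-\phi+f_u(x,0)\phi+\mu\phi\le0\}.$$ *)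

theory Defs
  imports "HOL-Analysis.Analysis"
begin

text \<open>
  \<open>Ck_on k S g\<close>: \<open>g\<close> is of class $C^k$ on \<open>S\<close>.  Derivatives are taken
  \<open>within S\<close>, so at a boundary point of a half-space they are one-sided.  Their
  uniqueness needs \<open>S\<close> to be, e.g., a convex set with nonempty interior, which
  is the case for the sets used here (the whole space and
  $\mathbb{R}^N \times [0,\infty)$).
\<close>

primrec Ck_on :: "nat \<Rightarrow> 'a::euclidean_space set \<Rightarrow> ('a \<Rightarrow> real) \<Rightarrow> bool" where
  "Ck_on 0 S g \<longleftrightarrow> continuous_on S g"
| "Ck_on (Suc k) S g \<longleftrightarrow>
     (\<exists>g'. (\<forall>x\<in>S. (g has_derivative g' x) (at x within S)) \<and>
           (\<forall>b\<in>Basis. Ck_on k S (\<lambda>x. g' x b)))"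

definition smooth :: "('a::euclidean_space \<Rightarrow> real) \<Rightarrow> bool" where
  "smooth g \<longleftrightarrow> (\<forall>k. Ck_on k UNIV g)"

definition periodic :: "(real^'n \<Rightarrow> 'b) \<Rightarrow> bool" where
  "periodic u \<longleftrightarrow> (\<forall>x k. (\<forall>i. k $ i \<in> \<int>) \<longrightarrow> u (x + k) = u x)"

definition C_per :: "(real^'n \<Rightarrow> real) set" where
  "C_per = {u. continuous_on UNIV u \<and> periodic u}"

definition conv :: "(real^'n \<Rightarrow> real) \<Rightarrow> (real^'n \<Rightarrow> real) \<Rightarrow> real^'n \<Rightarrow> real" (infixl "\<star>" 75)
  where "(J \<star> u) x = (LINT y|lebesgue. J (x - y) * u y)"

definition dispersal_kernel :: "(real^'n \<Rightarrow> real) \<Rightarrow> bool" where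
  "dispersal_kernel J \<longleftrightarrow>
     smooth J \<and> (\<forall>x. 0 \<le> J x) \<and> (LINT x|lebesgue. J x) = 1 \<and> 0 < J 0 \<and>
     (\<forall>x. J (- x) = J x) \<and> closure {x. J x \<noteq> 0} \<subseteq> cball 0 1"

text \<open>
  A nonlinearity is a total function of \<open>u :: real\<close>, but only its values for
  \<open>u \<ge> 0\<close> are ever constrained or used.  Monotonicity of $f(x,u)/u$ is strict:
  otherwise $f = 0$ would be admitted, for which all positive constants are
  stationary solutions.
\<close>

definition kpp_nonlinearity :: "(real^'n \<Rightarrow> real \<Rightarrow> real) \<Rightarrow> bool" where
  "kpp_nonlinearity f \<longleftrightarrow>
     (\<forall>u\<ge>0. periodic (\<lambda>x. f x u)) \<and>
     Ck_on 3 (UNIV \<times> {0..}) (\<lambda>(x, u). f x u) \<and>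
     (\<forall>x. f x 0 = 0) \<and>
     (\<forall>x. strict_antimono_on {0<..} (\<lambda>u. f x u / u)) \<and>
     (\<exists>M>0. \<forall>u\<ge>M. \<forall>x. f x u \<le> 0)"

text \<open>The partial derivative $f_u(x,u)$ for $u \ge 0$; one-sided at $u = 0$.\<close>

definition f_u :: "(real^'n \<Rightarrow> real \<Rightarrow> real) \<Rightarrow> real^'n \<Rightarrow> real \<Rightarrow> real" where
  "f_u f x u = vector_derivative (f x) (at u within {0..})"

definition mu0 :: "(real^'n \<Rightarrow> real) \<Rightarrow> (real^'n \<Rightarrow> real \<Rightarrow> real) \<Rightarrow> real" where
  "mu0 J f = Sup {\<mu>. \<exists>\<phi>\<in>C_per. (\<forall>x. 0 < \<phi> x) \<and>
     (\<forall>x. (J \<star> \<phi>) x - \<phi> x + f_u f x 0 * \<phi> x + \<mu> * \<phi> x \<le> 0)}"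

definition stationary_solution ::
  "(real^'n \<Rightarrow> real) \<Rightarrow> (real^'n \<Rightarrow> real \<Rightarrow> real) \<Rightarrow> (real^'n \<Rightarrow> real) \<Rightarrow> bool" where
  "stationary_solution J f u \<longleftrightarrow> (\<forall>x. (J \<star> u) x - u x + f x (u x) = 0)"

text \<open>
  Measurability is what gives the convolution a meaning for a discontinuous bounded
  \<open>u\<close>; without it the Bochner integral would silently default to 0.
\<close>

definition pos_bounded_periodic :: "(real^'n \<Rightarrow> real) set" where
  "pos_bounded_periodic =
     {u. (\<forall>x. 0 < u x) \<and> bounded (range u) \<and> periodic u \<and> u \<in> borel_measurable lebesgue}"

end

theory Submission
  imports Defs
begin

text \<open>
  If \<open>p\<close> is a positive solution, then \<open>f(x,p) / p < f_u(x,0)\<close> with a uniform gap, so \<open>p\<close> is a strict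
  subsolution of the linearized problem; touching a supersolution from below with a multiple of
  \<open>p\<close> bounds \<open>\<mu>\<^sub>0\<close> away from 0.

  Conversely, monotone iteration from a large constant gives positive continuous supersolutions
  \<open>U\<^sub>n\<close> decreasing to a solution \<open>w \<ge> 0\<close>.  The zero set of \<open>J \<star> w\<close> is open and closed.  If it is
  empty, the equation \<open>w - f(x,w) = J \<star> w\<close> makes \<open>w\<close> positive and Lipschitz.  Otherwise \<open>w = 0\<close>, so by
  Dini's theorem \<open>f(x,U\<^sub>n) / U\<^sub>n\<close> tends to \<open>f_u(x,0)\<close> uniformly, and \<open>U\<^sub>n\<close> itself is a
  test function for \<open>\<mu> = -\<epsilon>\<close>; hence \<open>\<mu>\<^sub>0 \<ge> 0\<close>.  No principal eigenfunction, which need not exist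
  for nonlocal operators, enters the argument.
\<close>

subsection \<open>Periodic functions\<close>

lemma integer_translate_into_unit_cube:
  fixes x :: "real^'n"
  obtains k :: "real^'n" where "\<forall>i. k $ i \<in> \<int>" and "x + k \<in> cbox 0 1"
proof
  let ?k = "(\<chi> i. - of_int \<lfloor>x $ i\<rfloor>) :: real^'n"
  show "\<forall>i. ?k $ i \<in> \<int>" by simp
  have "0 \<le> x $ i + - of_int \<lfloor>x $ i\<rfloor> \<and> x $ i + - of_int \<lfloor>x $ i\<rfloor> \<le> 1" for i
    by linarith
  then show "x + ?k \<in> cbox 0 1"
    by (auto simp: mem_box_cart)
qed

text \<open>\<open>periodic\<close> is polymorphic in the value type, so it applies to predicates as
  well. This transfers what compactness gives on the cube to the whole space.\<close>

lemma periodic_all_iff_unit_cube: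
  assumes "periodic P"
  shows "(\<forall>x::real^'n. P x) \<longleftrightarrow> (\<forall>x\<in>cbox 0 1. P x)"
  using assms unfolding periodic_def by (metis integer_translate_into_unit_cube)

text \<open>Compactness of the torus in usable form; every contact point in the comparison arguments
  below comes from here.\<close>

lemma C_per_attains_inf:
  fixes u :: "real^'n \<Rightarrow> real"
  assumes "u \<in> C_per"
  obtains x0 where "\<And>x. u x0 \<le> u x"
proof -
  have cont: "continuous_on (cbox 0 1) u" and per: "periodic u"
    using assms by (auto simp: C_per_def intro: continuous_on_subset)
  have ne: "cbox 0 (1::real^'n) \<noteq> {}"
    by (auto simp: interval_ne_empty_cart)
  obtain x0 where x0: "\<forall>y\<in>cbox 0 1. u x0 \<le> u y"
    using continuous_attains_inf[OF compact_cbox ne cont] by blast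
  have "periodic (\<lambda>y. u x0 \<le> u y)"
    using per by (simp add: periodic_def)
  then have "\<forall>y. u x0 \<le> u y"
    using periodic_all_iff_unit_cube x0 by metis
  then show ?thesis using that by blast
qed

lemma C_per_pos_lower_bound:
  fixes u :: "real^'n \<Rightarrow> real"
  assumes "u \<in> C_per" and "\<And>x. 0 < u x"
  obtains c where "0 < c" and "\<And>x. c \<le> u x"
  using C_per_attains_inf[OF assms(1)] assms(2) by metis

lemma C_per_bounded:
  fixes u :: "real^'n \<Rightarrow> real"
  assumes "u \<in> C_per"
  obtains B where "\<And>x. \<bar>u x\<bar> \<le> B"
proof -
  have "(\<lambda>x. - \<bar>u x\<bar>) \<in> C_per"
    using assms by (auto simp: C_per_def periodic_def intro!: continuous_intros)
  then obtain x0 where "\<And>x. - \<bar>u x0\<bar> \<le> - \<bar>u x\<bar>"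
    using C_per_attains_inf by metis
  then show ?thesis using that by force
qed

lemma C_per_bounded_range:
  fixes u :: "real^'n \<Rightarrow> real"
  assumes "u \<in> C_per"
  shows "bounded (range u)"
  using C_per_bounded[OF assms] by (metis bounded_iff imageE real_norm_def)

lemma C_per_diff: "u \<in> C_per \<Longrightarrow> v \<in> C_per \<Longrightarrow> (\<lambda>x. u x - v x) \<in> C_per"
  by (simp add: C_per_def periodic_def continuous_on_diff)

lemma C_per_cmult: "u \<in> C_per \<Longrightarrow> (\<lambda>x. c * u x) \<in> C_per"
  by (simp add: C_per_def periodic_def continuous_on_mult_left)

lemma C_per_divide:
  "u \<in> C_per \<Longrightarrow> v \<in> C_per \<Longrightarrow> (\<And>x. v x \<noteq> 0) \<Longrightarrow> (\<lambda>x. u x / v x) \<in> C_per"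
  by (simp add: C_per_def periodic_def continuous_on_divide)

lemma C_per_measurable:
  "u \<in> C_per \<Longrightarrow> u \<in> borel_measurable lebesgue"
  by (auto simp: C_per_def intro!: measurable_completion borel_measurable_continuous_onI)

text \<open>Dini's theorem on the torus.\<close>
lemma C_per_decreasing_null_sequence:
  fixes h :: "nat \<Rightarrow> real^'n \<Rightarrow> real"
  assumes h: "\<And>n. h n \<in> C_per" and dec: "\<And>n x. h (Suc n) x \<le> h n x"
    and lim: "\<And>x. (\<lambda>n. h n x) \<longlonglongrightarrow> 0" and "0 < \<epsilon>"
  shows "\<exists>n. \<forall>x. h n x < \<epsilon>"
proof (rule ccontr)
  assume "\<not> ?thesis"
  then have ex: "\<exists>x. \<epsilon> \<le> h n x" for n by (auto simp: not_less)
  \<comment> \<open>Nested nonempty compact superlevel sets share a point, and there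
    \<open>h n\<close> cannot tend to 0.\<close>
  define F where "F n = {x \<in> cbox 0 1. \<epsilon> \<le> h n x}" for n
  have "compact (F n)" for n
  proof -
    have "closed {x. \<epsilon> \<le> h n x}"
      using h[of n] by (intro closed_Collect_le continuous_intros) (auto simp: C_per_def)
    moreover have "F n = cbox 0 1 \<inter> {x. \<epsilon> \<le> h n x}" by (auto simp: F_def)
    ultimately show ?thesis by (simp add: compact_Int_closed)
  qed
  moreover have "F n \<noteq> {}" for n
  proof
    assume "F n = {}"
    then have "\<forall>x\<in>cbox 0 1. \<not> \<epsilon> \<le> h n x" by (auto simp: F_def)
    moreover have "periodic (\<lambda>x. \<not> \<epsilon> \<le> h n x)"
      using h[of n] by (simp add: C_per_def periodic_def)
    ultimately show False
      using ex periodic_all_iff_unit_cube by blast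
  qed
  moreover have "F n \<subseteq> F m" if "m \<le> n" for m n
  proof -
    have "h n x \<le> h m x" for x
      using lift_Suc_antimono_le[of "\<lambda>n. h n x", OF dec that] .
    then show ?thesis unfolding F_def by (auto intro: order_trans)
  qed
  ultimately have "\<Inter> (range F) \<noteq> {}"
    by (rule compact_nest)
  then obtain x where "\<And>n. \<epsilon> \<le> h n x" by (auto simp: F_def)
  then have "\<epsilon> \<le> 0" by (intro LIMSEQ_le_const[OF lim]) auto
  with \<open>0 < \<epsilon>\<close> show False by simp
qed

subsection \<open>Functions of class C1\<close>

lemma Ck_on_imp_continuous_on: "Ck_on k S g \<Longrightarrow> continuous_on S g"
  by (cases k) (auto intro: has_derivative_continuous_on)

text \<open>Continuous partial derivatives are bounded on compact \<open>K\<close>, hence so is the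
  operator norm of the derivative; convexity of \<open>K\<close> allows the mean value
  inequality.\<close>

lemma Ck_on_Suc_imp_lipschitz_on_compact:
  assumes "Ck_on (Suc k) S g" and "K \<subseteq> S" and "compact K" and "convex K"
  obtains L where "L-lipschitz_on K g"
proof -
  obtain g' where g': "\<And>x. x \<in> S \<Longrightarrow> (g has_derivative g' x) (at x within S)"
    and ck: "\<And>b. b \<in> Basis \<Longrightarrow> Ck_on k S (\<lambda>x. g' x b)"
    using assms(1) by auto
  let ?N = "\<lambda>x. \<Sum>b\<in>Basis. norm (g' x b)"
  have "continuous_on K (\<lambda>x. g' x b)" if "b \<in> Basis" for b
    using Ck_on_imp_continuous_on[OF ck[OF that]] assms(2) continuous_on_subset by blast
  then have "continuous_on K ?N"
    by (intro continuous_intros) auto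
  then have "bounded (?N ` K)"
    using assms(3) by (rule compact_imp_bounded[OF compact_continuous_image])
  then obtain B where B: "0 < B" "\<And>x. x \<in> K \<Longrightarrow> norm (?N x) \<le> B"
    unfolding bounded_pos by auto
  have "B-lipschitz_on K g"
  proof (rule bounded_derivative_imp_lipschitz)
    fix x assume x: "x \<in> K"
    then show d: "(g has_derivative g' x) (at x within K)"
      using g' assms(2) has_derivative_subset by blast
    show "onorm (g' x) \<le> B"
      using onorm_componentwise[OF has_derivative_bounded_linear[OF d]] B(2)[OF x]
      by (simp add: abs_of_nonneg sum_nonneg)
  qed (use B assms in auto)
  then show ?thesis by (rule that)
qed

text \<open>At distance above 1 the oscillation \<open>2 * B\<close> is itself at most
  \<open>2 * B * dist x y\<close>. Compactness yields estimates only for nearby points; boundedness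
  makes them global.\<close>

lemma lipschitz_onI_local:
  fixes g :: "'a::metric_space \<Rightarrow> real"
  assumes bd: "\<And>x. \<bar>g x\<bar> \<le> B" and "0 \<le> L"
    and loc: "\<And>x y. dist x y \<le> 1 \<Longrightarrow> \<bar>g x - g y\<bar> \<le> L * dist x y"
  shows "(L + 2 * B)-lipschitz_on UNIV g"
proof (rule lipschitz_onI)
  have "0 \<le> B" using bd[of undefined] by linarith
  then show "0 \<le> L + 2 * B" using \<open>0 \<le> L\<close> by simp
  fix x y :: 'a
  show "dist (g x) (g y) \<le> (L + 2 * B) * dist x y"
  proof (cases "dist x y \<le> 1")
    case True
    have "0 \<le> 2 * B * dist x y" using \<open>0 \<le> B\<close> by simp
    with loc[OF True] show ?thesis by (simp add: dist_real_def distrib_right)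
  next
    case False
    have "\<bar>g x - g y\<bar> \<le> 2 * B" using bd[of x] bd[of y] by linarith
    also have "\<dots> \<le> 2 * B * dist x y"
      using mult_left_mono[of 1 "dist x y" "2 * B"] False \<open>0 \<le> B\<close> by simp
    also have "\<dots> \<le> (L + 2 * B) * dist x y" using \<open>0 \<le> L\<close> by (simp add: distrib_right)
    finally show ?thesis by (simp add: dist_real_def)
  qed
qed

subsection \<open>Convolution with the dispersal kernel\<close>

lemma distr_lebesgue_plus:
  fixes t :: "'a::euclidean_space"
  shows "distr lebesgue lebesgue ((+) t) = lebesgue"
    and "(+) t \<in> lebesgue \<rightarrow>\<^sub>M lebesgue"
proof -
  \<comment> \<open>The affine maps of the measure theorems carry one scaling factor per coordinate;
    factor 1 everywhere leaves a translation.\<close>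
  have T: "(\<lambda>x. t + (\<Sum>j\<in>Basis. (1 * (x \<bullet> j)) *\<^sub>R j)) = (+) t"
    by (simp add: euclidean_representation fun_eq_iff)
  show "(+) t \<in> lebesgue \<rightarrow>\<^sub>M lebesgue"
    using lebesgue_affine_measurable[where c = "\<lambda>_. 1" and t = t] unfolding T by simp
  show "distr lebesgue lebesgue ((+) t) = lebesgue"
    using lebesgue_affine_euclidean[where c = "\<lambda>_. 1" and t = t] unfolding T
    by (simp add: density_1)
qed

lemma lebesgue_integral_translation:
  fixes g :: "'a::euclidean_space \<Rightarrow> real"
  assumes "g \<in> borel_measurable lebesgue"
  shows "(LINT y|lebesgue. g (t + y)) = (LINT y|lebesgue. g y)"
  using integral_distr[OF distr_lebesgue_plus(2) assms, of t]
  by (simp add: distr_lebesgue_plus(1))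

section \<open>Support, bounds and regularity of the kernel\<close>

lemma dispersal_kernel_props:
  assumes "dispersal_kernel J"
  shows kernel_continuous: "continuous_on UNIV J"
    and kernel_nonneg: "0 \<le> J x"
    and kernel_integral: "(LINT x|lebesgue. J x) = 1"
    and kernel_sym: "J (- x) = J x"
    and kernel_support: "1 < norm x \<Longrightarrow> J x = 0"
    and kernel_zero_pos: "0 < J 0"
proof -
  have D: "smooth J" "\<forall>x. 0 \<le> J x" "(LINT x|lebesgue. J x) = 1" "0 < J 0"
      "\<forall>x. J (- x) = J x" "closure {x. J x \<noteq> 0} \<subseteq> cball 0 1"
    using assms[unfolded dispersal_kernel_def] by simp_all
  show "continuous_on UNIV J"
    using D(1) Ck_on_imp_continuous_on unfolding smooth_def by blast
  show "J x = 0" if "1 < norm x"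
  proof (rule ccontr)
    assume "J x \<noteq> 0"
    then have "x \<in> closure {x. J x \<noteq> 0}" using closure_subset[of "{x. J x \<noteq> 0}"] by blast
    then have "x \<in> cball 0 1" using D(6) by (rule rev_subsetD)
    then show False using that by simp
  qed
  show "0 \<le> J x" "(LINT x|lebesgue. J x) = 1" "J (- x) = J x" "0 < J 0"
    using D(2-5) by simp_all
qed

lemma kernel_pos_near_zero:
  assumes "dispersal_kernel J"
  obtains r where "0 < r" and "\<And>z. norm z < r \<Longrightarrow> 0 < J z"
proof -
  have "isCont J 0"
    using kernel_continuous[OF assms] by (simp add: continuous_on_eq_continuous_at)
  then obtain r where "0 < r" "\<And>z. dist z 0 < r \<Longrightarrow> dist (J z) (J 0) < J 0"
    using kernel_zero_pos[OF assms] by (metis continuous_at_eps_delta)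
  then have "0 < J z" if "norm z < r" for z
    using that \<open>\<And>z. dist z 0 < r \<Longrightarrow> dist (J z) (J 0) < J 0\<close>[of z]
    by (simp add: dist_real_def abs_less_iff)
  then show ?thesis using that \<open>0 < r\<close> by blast
qed

lemma kernel_bounded:
  fixes J :: "real^'n \<Rightarrow> real"
  assumes "dispersal_kernel J"
  obtains B where "\<And>x. J x \<le> B"
proof -
  have "bounded (J ` cball 0 1)"
    by (rule compact_imp_bounded[OF compact_continuous_image[OF
            continuous_on_subset[OF kernel_continuous[OF assms] subset_UNIV] compact_cball]])
  then obtain B where "\<forall>z\<in>J ` cball 0 1. norm z \<le> B"
    unfolding bounded_iff by blast
  then have B: "\<And>x. x \<in> cball 0 1 \<Longrightarrow> \<bar>J x\<bar> \<le> B" by simp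
  have "J x \<le> max B 0" for x
    using B[of x] kernel_support[OF assms, of x] by (cases "norm x \<le> 1") (auto simp: max_def)
  then show ?thesis by (rule that)
qed

text \<open>For two points at distance at most 1, either both lie in the ball of radius 2 or
  \<open>J\<close> vanishes at both.\<close>

lemma kernel_lipschitz:
  fixes J :: "real^'n \<Rightarrow> real"
  assumes "dispersal_kernel J"
  obtains L where "L-lipschitz_on UNIV J"
proof -
  have "Ck_on (Suc 0) UNIV J"
    using assms unfolding dispersal_kernel_def smooth_def by blast
  then obtain L where L: "L-lipschitz_on (cball 0 2) J"
    by (rule Ck_on_Suc_imp_lipschitz_on_compact[OF _ subset_UNIV compact_cball convex_cball])
  obtain B where B: "\<And>x. J x \<le> B" using kernel_bounded[OF assms] by blast
  have "(L + 2 * B)-lipschitz_on UNIV J"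
  proof (rule lipschitz_onI_local)
    show "\<bar>J x\<bar> \<le> B" for x using B[of x] kernel_nonneg[OF assms, of x] by simp
    show "0 \<le> L" using L lipschitz_on_nonneg by blast
    fix x y :: "real^'n" assume xy: "dist x y \<le> 1"
    show "\<bar>J x - J y\<bar> \<le> L * dist x y"
    proof (cases "norm x \<le> 1 \<or> norm y \<le> 1")
      case True
      then have "norm x \<le> 2 \<and> norm y \<le> 2"
        using xy norm_triangle_ineq3[of x y] unfolding dist_norm by linarith
      then show ?thesis using lipschitz_onD[OF L, of x y] by (simp add: dist_real_def)
    next
      case False
      then show ?thesis using kernel_support[OF assms] \<open>0 \<le> L\<close> by simp
    qed
  qed
  then show ?thesis by (rule that)
qed

section \<open>Integrability, order, periodicity and smoothing of the convolution\<close>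

lemma kernel_shift_measurable:
  fixes J :: "real^'n \<Rightarrow> real"
  assumes "dispersal_kernel J"
  shows "(\<lambda>y. J (x - y)) \<in> borel_measurable lebesgue"
proof -
  have "continuous_on UNIV (\<lambda>y. J (x - y))"
    by (rule continuous_on_compose2[OF kernel_continuous[OF assms]]) (auto intro!: continuous_intros)
  then show ?thesis
    using borel_measurable_continuous_onI by (intro measurable_completion) simp
qed

lemma integrable_indicator_cball:
  "integrable lebesgue (indicat_real (cball (x::real^'n) r))"
  using emeasure_bounded_finite[of "cball x r"] by (intro integrable_real_indicator) (auto simp: emeasure_completion)

lemma conv_integrable:
  fixes J :: "real^'n \<Rightarrow> real"
  assumes J: "dispersal_kernel J" and u: "u \<in> borel_measurable lebesgue" "bounded (range u)"
  shows "integrable lebesgue (\<lambda>y. J (x - y) * u y)"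
proof -
  obtain B where B: "\<And>x. J x \<le> B" using kernel_bounded[OF J] by blast
  obtain C where C: "\<And>x. \<bar>u x\<bar> \<le> C" using u(2) by (auto simp: bounded_iff)
  have nn: "0 \<le> J z" for z by (rule kernel_nonneg[OF J])
  show ?thesis
  proof (rule Bochner_Integration.integrable_bound)
    show "integrable lebesgue (\<lambda>y. B * C * indicator (cball x 1) y)"
      using integrable_indicator_cball by (rule integrable_mult_right)
    show "(\<lambda>y. J (x - y) * u y) \<in> borel_measurable lebesgue"
      using kernel_shift_measurable[OF J] u(1) by (rule borel_measurable_times)
    have "\<bar>J (x - y) * u y\<bar> \<le> \<bar>B * C * indicator (cball x 1) y\<bar>" for y
    proof (cases "norm (x - y) \<le> 1")
      case True
      have "\<bar>J (x - y) * u y\<bar> \<le> B * C"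
        using B[of "x - y"] C[of y] nn[of "x - y"] by (auto simp: abs_mult intro!: mult_mono)
      then show ?thesis using True by (simp add: dist_norm)
    next
      case False
      then show ?thesis using kernel_support[OF J] by simp
    qed
    then show "AE y in lebesgue. norm (J (x - y) * u y) \<le> norm (B * C * indicator (cball x 1) y)"
      by simp
  qed
qed

lemma conv_const:
  fixes J :: "real^'n \<Rightarrow> real"
  assumes J: "dispersal_kernel J"
  shows "(J \<star> (\<lambda>_. c)) x = c"
proof -
  \<comment> \<open>Symmetry of \<open>J\<close> replaces the reflection in \<open>y\<close> by a
    translation, under which the integral is invariant.\<close>
  have eq: "J (x - y) = J (- x + y)" for y
    using kernel_sym[OF J, of "x - y"] by simp
  have "J \<in> borel_measurable lebesgue"
    using kernel_shift_measurable[OF J, of 0] kernel_sym[OF J] by simp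
  then have "(LINT y|lebesgue. J (x - y)) = 1"
    unfolding eq using lebesgue_integral_translation kernel_integral[OF J] by metis
  then show ?thesis by (simp add: conv_def)
qed

lemma conv_mono:
  fixes J :: "real^'n \<Rightarrow> real"
  assumes J: "dispersal_kernel J" and u: "u \<in> borel_measurable lebesgue" "bounded (range u)"
    and v: "v \<in> borel_measurable lebesgue" "bounded (range v)" and le: "\<And>y. u y \<le> v y"
  shows "(J \<star> u) x \<le> (J \<star> v) x"
  unfolding conv_def
  by (intro integral_mono conv_integrable assms mult_left_mono kernel_nonneg)

lemma conv_cmult: "(J \<star> (\<lambda>y. t * u y)) x = t * (J \<star> u) x"
  unfolding conv_def by (simp add: mult.left_commute)

lemma conv_periodic:
  fixes J :: "real^'n \<Rightarrow> real"
  assumes J: "dispersal_kernel J" and u: "u \<in> borel_measurable lebesgue" "periodic u"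
  shows "periodic (J \<star> u)"
  unfolding periodic_def
proof (intro allI impI)
  fix x k :: "real^'n" assume k: "\<forall>i. k $ i \<in> \<int>"
  have "(J \<star> u) (x + k) = (LINT y|lebesgue. J (x + k - (k + y)) * u (k + y))"
    unfolding conv_def
    by (rule lebesgue_integral_translation[symmetric])
      (rule borel_measurable_times[OF kernel_shift_measurable[OF J] u(1)])
  also have "\<dots> = (J \<star> u) x"
    using u(2) k unfolding conv_def periodic_def by (simp add: add.commute[of k])
  finally show "(J \<star> u) (x + k) = (J \<star> u) x" .
qed

text \<open>The difference of the integrands lives on two unit balls of equal volume
  \<open>V\<close>, where the Lipschitz bound of \<open>J\<close> applies. This smoothing is what
  later makes merely measurable solutions continuous.\<close>

lemma conv_lipschitz:
  fixes J :: "real^'n \<Rightarrow> real"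
  assumes J: "dispersal_kernel J" and u: "u \<in> borel_measurable lebesgue" "bounded (range u)"
  obtains L where "L-lipschitz_on UNIV (J \<star> u)"
proof -
  obtain L where L: "L-lipschitz_on UNIV J" using kernel_lipschitz[OF J] by blast
  obtain C where C: "\<And>x. \<bar>u x\<bar> \<le> C" using u(2) by (auto simp: bounded_iff)
  have "0 \<le> C" using C[of undefined] by simp
  define V where "V = measure lebesgue (cball (0::real^'n) 1)"
  have V: "(LINT y|lebesgue. indicator (cball x 1) y) = V" for x :: "real^'n"
    by (simp add: V_def content_cball)
  have "(L * C * (2 * V))-lipschitz_on UNIV (J \<star> u)"
  proof (rule lipschitz_onI)
    show "0 \<le> L * C * (2 * V)"
      using \<open>0 \<le> C\<close> lipschitz_on_nonneg[OF L] by (simp add: V_def)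
    fix x z :: "real^'n"
    let ?I = "\<lambda>y. indicat_real (cball x 1) y + indicator (cball z 1) y"
    have bd: "\<bar>J (x - y) * u y - J (z - y) * u y\<bar> \<le> L * C * dist x z * ?I y" for y
    proof (cases "y \<in> cball x 1 \<or> y \<in> cball z 1")
      case True
      have "\<bar>J (x - y) - J (z - y)\<bar> \<le> L * dist x z"
        using lipschitz_onD[OF L, of "x - y" "z - y"] by (simp add: dist_norm)
      then have "\<bar>J (x - y) - J (z - y)\<bar> * \<bar>u y\<bar> \<le> L * dist x z * C"
        using C[of y] lipschitz_on_nonneg[OF L] by (intro mult_mono) auto
      then have "\<bar>J (x - y) * u y - J (z - y) * u y\<bar> \<le> L * C * dist x z * 1"
        unfolding left_diff_distrib[symmetric] abs_mult by (simp add: mult_ac)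
      also have "\<dots> \<le> L * C * dist x z * ?I y"
        using True lipschitz_on_nonneg[OF L] \<open>0 \<le> C\<close>
        by (intro mult_left_mono) (auto simp: indicator_def)
      finally show ?thesis .
    next
      case False
      then show ?thesis using kernel_support[OF J] by (simp add: dist_norm)
    qed
    have "\<bar>(J \<star> u) x - (J \<star> u) z\<bar> = \<bar>LINT y|lebesgue. J (x - y) * u y - J (z - y) * u y\<bar>"
      unfolding conv_def by (simp add: conv_integrable[OF J u])
    also have "\<dots> \<le> (LINT y|lebesgue. \<bar>J (x - y) * u y - J (z - y) * u y\<bar>)"
      using integral_norm_bound by (metis (no_types) real_norm_def integral_abs_bound)
    also have "\<dots> \<le> (LINT y|lebesgue. L * C * dist x z * ?I y)"
      by (intro integral_mono bd integrable_abs Bochner_Integration.integrable_diff conv_integrable[OF J u]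
          integrable_mult_right Bochner_Integration.integrable_add integrable_indicator_cball)
    also have "\<dots> = L * C * dist x z * (V + V)"
      using V by (simp add: integrable_indicator_cball)
    finally show "dist ((J \<star> u) x) ((J \<star> u) z) \<le> L * C * (2 * V) * dist x z"
      by (simp add: dist_real_def mult_ac)
  qed
  then show ?thesis by (rule that)
qed

lemma conv_C_per:
  fixes J :: "real^'n \<Rightarrow> real"
  assumes J: "dispersal_kernel J" and u: "u \<in> borel_measurable lebesgue" "bounded (range u)" "periodic u"
  shows "J \<star> u \<in> C_per"
  using conv_lipschitz[OF J u(1,2)] conv_periodic[OF J u(1,3)] lipschitz_on_continuous_on
  unfolding C_per_def by blast

section \<open>Positivity of the convolution and its zeros\<close>

lemma conv_nonneg:
  fixes J :: "real^'n \<Rightarrow> real"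
  assumes J: "dispersal_kernel J" and "\<And>y. 0 \<le> u y"
  shows "0 \<le> (J \<star> u) x"
  unfolding conv_def using assms by (intro integral_nonneg_AE) (simp add: kernel_nonneg)

text \<open>A nonnegative integrand with integral 0 vanishes almost everywhere, and the factor
  \<open>J (x - y)\<close> is positive on the ball.\<close>

lemma conv_eq_0_imp:
  fixes J :: "real^'n \<Rightarrow> real"
  assumes J: "dispersal_kernel J" and r: "\<And>z. norm z < r \<Longrightarrow> 0 < J z"
    and u: "u \<in> borel_measurable lebesgue" "bounded (range u)" "\<And>y. 0 \<le> u y"
    and eq: "(J \<star> u) x = 0"
  shows "negligible {y \<in> ball x r. u y \<noteq> 0}"
proof -
  have "AE y in lebesgue. J (x - y) * u y = 0"
    using eq unfolding conv_def
    by (subst (asm) integral_nonneg_eq_0_iff_AE)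
      (auto simp: u kernel_nonneg[OF J] intro!: conv_integrable[OF J u(1,2)])
  then obtain N where "negligible N" "{y. J (x - y) * u y \<noteq> 0} \<subseteq> N"
    unfolding eventually_ae_filter_negligible by auto
  moreover have "{y \<in> ball x r. u y \<noteq> 0} \<subseteq> {y. J (x - y) * u y \<noteq> 0}"
    using r by (force simp: dist_norm)
  ultimately show ?thesis by (meson negligible_subset subset_trans)
qed

lemma conv_pos:
  fixes J :: "real^'n \<Rightarrow> real"
  assumes J: "dispersal_kernel J" and u: "u \<in> borel_measurable lebesgue" "bounded (range u)"
    and pos: "\<And>y. 0 < u y"
  shows "0 < (J \<star> u) x"
proof (rule ccontr)
  assume "\<not> 0 < (J \<star> u) x"
  then have eq: "(J \<star> u) x = 0" using conv_nonneg[OF J, of u x] pos by (simp add: less_imp_le)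
  obtain r where r: "0 < r" "\<And>z. norm z < r \<Longrightarrow> 0 < J z" using kernel_pos_near_zero[OF J] by blast
  have "negligible {y \<in> ball x r. u y \<noteq> 0}"
    using conv_eq_0_imp[OF J r(2) u less_imp_le[OF pos] eq] .
  moreover have "{y \<in> ball x r. u y \<noteq> 0} = ball x r" using pos by (auto simp: less_imp_neq[symmetric] dest: less_imp_neq)
  ultimately show False using open_not_negligible[of "ball x r"] r(1) by simp
qed

subsection \<open>The nonlinearity\<close>

lemma kpp_props:
  assumes "kpp_nonlinearity f"
  shows kpp_periodic: "0 \<le> u \<Longrightarrow> periodic (\<lambda>x. f x u)"
    and kpp_Ck: "Ck_on 3 (UNIV \<times> {0..}) (\<lambda>(x, u). f x u)"
    and kpp_zero: "f x 0 = 0"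
    and kpp_ratio_less: "0 < s \<Longrightarrow> s < t \<Longrightarrow> f x t / t < f x s / s"
    and kpp_threshold: "\<exists>M>0. \<forall>u\<ge>M. \<forall>x. f x u \<le> 0"
  using assms unfolding kpp_nonlinearity_def
  by (auto simp: monotone_on_def)

text \<open>Periodicity reduces the claim to a compact convex set: one integer vector moves
  \<open>x\<close> into the unit cube and takes \<open>y\<close> along, at distance at most 1. Hence
  the radius \<open>R + 1\<close> and a constant uniform in space.\<close>

lemma kpp_lipschitz:
  fixes f :: "real^'n \<Rightarrow> real \<Rightarrow> real"
  assumes f: "kpp_nonlinearity f"
  obtains L where "0 \<le> L" and "\<And>x y s t. \<lbrakk>dist x y \<le> 1; s \<in> {0..A}; t \<in> {0..A}\<rbrakk> \<Longrightarrow>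
    \<bar>f x s - f y t\<bar> \<le> L * (dist x y + \<bar>s - t\<bar>)"
proof -
  obtain R where R: "\<And>x. x \<in> cbox 0 (1::real^'n) \<Longrightarrow> norm x \<le> R"
    using bounded_cbox bounded_iff by metis
  let ?K = "cball (0::real^'n) (R + 1) \<times> {0..A}"
  have "Ck_on (Suc 2) (UNIV \<times> {0..}) (\<lambda>(x, u). f x u)"
    using kpp_Ck[OF f] by (simp add: numeral_3_eq_3 numeral_2_eq_2)
  moreover have "?K \<subseteq> UNIV \<times> {0..}" by auto
  moreover have "compact ?K" by (intro compact_Times) auto
  moreover have "convex ?K" by (intro convex_Times) auto
  ultimately obtain L where L: "L-lipschitz_on ?K (\<lambda>(x, u). f x u)"
    by (rule Ck_on_Suc_imp_lipschitz_on_compact)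
  have "\<bar>f x s - f y t\<bar> \<le> L * (dist x y + \<bar>s - t\<bar>)"
    if "dist x y \<le> 1" and st: "s \<in> {0..A}" "t \<in> {0..A}" for x y :: "real^'n" and s t
  proof -
    obtain k :: "real^'n" where k: "\<forall>i. k $ i \<in> \<int>" "x + k \<in> cbox 0 1"
      using integer_translate_into_unit_cube by blast
    have nx: "norm (x + k) \<le> R" using R k(2) by blast
    have d: "dist (x + k) (y + k) = dist x y" by simp
    have "norm (y + k) \<le> R + 1"
      using nx d that(1) norm_triangle_ineq3[of "x + k" "y + k"] unfolding dist_norm by linarith
    with nx have "(x + k, s) \<in> ?K" "(y + k, t) \<in> ?K" using st by auto
    from lipschitz_onD[OF L this]
    have "\<bar>f (x + k) s - f (y + k) t\<bar> \<le> L * dist (x + k, s) (y + k, t)"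
      by (simp add: dist_real_def)
    also have "dist (x + k, s) (y + k, t) \<le> dist x y + \<bar>s - t\<bar>"
      unfolding dist_Pair_Pair d dist_real_def
      using sqrt_sum_squares_le_sum[of "dist x y" "\<bar>s - t\<bar>"] by simp
    finally have "\<bar>f (x + k) s - f (y + k) t\<bar> \<le> L * (dist x y + \<bar>s - t\<bar>)"
      using lipschitz_on_nonneg[OF L] by (simp add: mult_left_mono)
    moreover have "f (x + k) s = f x s" "f (y + k) t = f y t"
      using kpp_periodic[OF f] k(1) st unfolding periodic_def by auto
    ultimately show ?thesis by simp
  qed
  then show ?thesis using that lipschitz_on_nonneg[OF L] by blast
qed

lemma kpp_comp_C_per:
  fixes f :: "real^'n \<Rightarrow> real \<Rightarrow> real"
  assumes f: "kpp_nonlinearity f" and u: "u \<in> C_per" and nn: "\<And>x. 0 \<le> u x"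
  shows "(\<lambda>x. f x (u x)) \<in> C_per"
proof -
  have "continuous_on UNIV (\<lambda>x. (\<lambda>(x, u). f x u) (x, u x))"
    by (rule continuous_on_compose2[OF Ck_on_imp_continuous_on[OF kpp_Ck[OF f]]])
      (use u nn in \<open>auto simp: C_per_def intro!: continuous_intros\<close>)
  moreover have "periodic (\<lambda>x. f x (u x))"
    using kpp_periodic[OF f nn] u unfolding C_per_def periodic_def by auto
  ultimately show ?thesis by (simp add: C_per_def)
qed

lemma kpp_f_u_at_0:
  fixes f :: "real^'n \<Rightarrow> real \<Rightarrow> real"
  assumes f: "kpp_nonlinearity f"
  shows kpp_has_derivative_at_0: "(f x has_vector_derivative f_u f x 0) (at 0 within {0..})"
    and kpp_f_u_C_per: "(\<lambda>x. f_u f x 0) \<in> C_per"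
proof -
  let ?S = "UNIV \<times> {0..} :: ((real^'n) \<times> real) set"
  have "Ck_on (Suc 2) ?S (\<lambda>(x, u). f x u)"
    using kpp_Ck[OF f] by (simp add: numeral_3_eq_3 numeral_2_eq_2)
  then obtain g' where g': "\<And>z. z \<in> ?S \<Longrightarrow> ((\<lambda>(x, u). f x u) has_derivative g' z) (at z within ?S)"
    and ck: "\<And>b. b \<in> Basis \<Longrightarrow> Ck_on 2 ?S (\<lambda>z. g' z b)"
    unfolding Ck_on.simps by blast
  \<comment> \<open>Nontriviality of this filter makes the one-sided derivative unique.\<close>
  have nb: "at (0::real) within {0..} \<noteq> bot"
    by (simp add: at_within_Ici_at_right)
  have der: "(f x has_vector_derivative g' (x, 0) (0, 1)) (at 0 within {0..})" for x
  proof -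
    have lin: "bounded_linear (g' (x, 0))"
      by (rule has_derivative_bounded_linear[OF g']) simp
    have d1: "((\<lambda>(x, u). f x u) has_derivative g' (x, 0)) (at (x, 0) within Pair x ` {0..})"
      by (rule has_derivative_subset[OF g']) auto
    have d2: "(Pair x has_derivative Pair 0) (at (0::real) within {0..})"
      by (intro has_derivative_Pair has_derivative_const has_derivative_ident)
    have "((\<lambda>u. (\<lambda>(x, u). f x u) (x, u)) has_derivative (\<lambda>h. g' (x, 0) (0, h))) (at 0 within {0..})"
      by (rule has_derivative_in_compose[OF d2 d1])
    moreover have "(\<lambda>h. g' (x, 0) (0, h)) = (\<lambda>h. h *\<^sub>R g' (x, 0) (0, 1))"
    proof
      fix h :: real
      have "h *\<^sub>R (0, 1) = (0 :: real^'n, h)" by simp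
      then show "g' (x, 0) (0, h) = h *\<^sub>R g' (x, 0) (0, 1)"
        using linear_simps(5)[OF lin, of h "(0, 1)"] by (simp only:)
    qed
    ultimately show ?thesis unfolding has_vector_derivative_def by (simp only: prod.case)
  qed
  have eq: "f_u f x 0 = g' (x, 0) (0, 1)" for x
    unfolding f_u_def by (rule vector_derivative_within[OF nb der])
  show "(f x has_vector_derivative f_u f x 0) (at 0 within {0..})"
    using der eq by simp
  have "continuous_on ?S (\<lambda>z. g' z (0, 1))"
    by (rule Ck_on_imp_continuous_on[OF ck]) (simp add: Basis_prod_def)
  then have "continuous_on UNIV (\<lambda>x. (\<lambda>z. g' z (0, 1)) (x, 0))"
    by (rule continuous_on_compose2) (auto intro!: continuous_intros)
  then have "continuous_on UNIV (\<lambda>x. f_u f x 0)" by (simp add: eq)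
  moreover have "periodic (\<lambda>x. f_u f x 0)"
    unfolding periodic_def
  proof (intro allI impI)
    fix x k :: "real^'n" assume k: "\<forall>i. k $ i \<in> \<int>"
    have "f (x + k) s = f x s" if "0 \<le> s" for s
      using kpp_periodic[OF f that] k by (simp add: periodic_def)
    \<comment> \<open>Periodicity of \<open>f\<close> is known for nonnegative arguments, which is
      all that the filter within \<open>{0..}\<close> sees.\<close>
    then have "(f x has_vector_derivative g' (x + k, 0) (0, 1)) (at 0 within {0..})"
      by (intro has_vector_derivative_transform[OF _ _ der]) auto
    then show "f_u f (x + k) 0 = f_u f x 0"
      unfolding eq by (rule vector_derivative_unique_within[OF nb _ der])
  qed
  ultimately show "(\<lambda>x. f_u f x 0) \<in> C_per" by (simp add: C_per_def)
qed

lemma kpp_ratio_tendsto: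
  fixes f :: "real^'n \<Rightarrow> real \<Rightarrow> real"
  assumes f: "kpp_nonlinearity f"
  shows "((\<lambda>s. f x s / s) \<longlongrightarrow> f_u f x 0) (at_right 0)"
proof -
  have "(f x has_real_derivative f_u f x 0) (at 0 within {0..})"
    using kpp_has_derivative_at_0[OF f] by (simp add: has_real_derivative_iff_has_vector_derivative)
  then show ?thesis
    by (simp add: has_field_derivative_iff kpp_zero[OF f] at_within_Ici_at_right)
qed

text \<open>The limit at 0 alone would give a weak inequality; the intermediate point
  \<open>s / 2\<close> restores strictness.\<close>

lemma kpp_ratio_less_f_u:
  fixes f :: "real^'n \<Rightarrow> real \<Rightarrow> real"
  assumes f: "kpp_nonlinearity f" and "0 < s"
  shows "f x s / s < f_u f x 0"
proof -
  have "eventually (\<lambda>t. f x (s / 2) / (s / 2) \<le> f x t / t) (at_right 0)"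
    unfolding eventually_at_right_field
    using kpp_ratio_less[OF f, of _ "s / 2" x] \<open>0 < s\<close> by (intro exI[of _ "s / 2"]) (auto intro: less_imp_le)
  then have "f x (s / 2) / (s / 2) \<le> f_u f x 0"
    by (intro tendsto_lowerbound[OF kpp_ratio_tendsto[OF f]]) auto
  moreover have "f x s / s < f x (s / 2) / (s / 2)"
    by (rule kpp_ratio_less[OF f]) (use \<open>0 < s\<close> in auto)
  ultimately show ?thesis by linarith
qed

subsection \<open>Regularity and uniqueness of solutions\<close>

text \<open>A solution solves \<open>u - f(x, u) = J \<star> u\<close> at each point.  Since \<open>f(x, u) / u\<close> decreases,
  the left-hand side grows in \<open>u\<close> at rate at least \<open>1 - f(x, u) / u = (J \<star> u) / u\<close>, so \<open>u\<close>
  inherits the regularity of \<open>J \<star> u\<close>.\<close>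
lemma stationary_solution_lipschitz:
  fixes J :: "real^'n \<Rightarrow> real"
  assumes J: "dispersal_kernel J" and f: "kpp_nonlinearity f"
    and u: "u \<in> borel_measurable lebesgue" "bounded (range u)" "\<And>x. 0 \<le> u x"
    and sol: "stationary_solution J f u" and c: "0 < c" "\<And>x. c \<le> (J \<star> u) x"
  shows "\<exists>L. L-lipschitz_on UNIV u"
proof -
  obtain A where A: "0 < A" "\<And>x. \<bar>u x\<bar> \<le> A" using u(2) by (auto simp: bounded_pos)
  obtain Lf where Lf: "0 \<le> Lf" "\<And>x y s t. \<lbrakk>dist x y \<le> 1; s \<in> {0..A}; t \<in> {0..A}\<rbrakk> \<Longrightarrow>
      \<bar>f x s - f y t\<bar> \<le> Lf * (dist x y + \<bar>s - t\<bar>)"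
    using kpp_lipschitz[OF f, of A] by metis
  obtain Lv where Lv: "Lv-lipschitz_on UNIV (J \<star> u)"
    using conv_lipschitz[OF J u(1,2)] by blast
  have eqn: "u x - f x (u x) = (J \<star> u) x" for x
    using sol unfolding stationary_solution_def by (simp add: algebra_simps)
  have pos: "0 < u x" for x
    using u(3)[of x] eqn[of x] c(1) c(2)[of x] kpp_zero[OF f, of x] by (cases "u x = 0") auto
  \<comment> \<open>\<open>Lv + Lf\<close> bounds the effect of moving \<open>x\<close> with the
    value of \<open>u\<close> frozen, and \<open>A / c\<close> is the inverse of the lower bound on
    the growth rate in \<open>u\<close>.\<close>
  define L where "L = (Lv + Lf) * A / c"
  have Lnn: "0 \<le> L" using Lf(1) lipschitz_on_nonneg[OF Lv] A(1) c(1) by (simp add: L_def)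
  have le: "u x - u y \<le> L * dist x y" if d: "dist x y \<le> 1" for x y
  proof (cases "u x \<le> u y")
    case True
    have "0 \<le> L * dist x y" using Lnn by simp
    then show ?thesis using True by linarith
  next
    case False
    define p q where "p = u x" and "q = u y"
    have pq: "0 < q" "q < p" "p \<le> A"
      using False pos[of y] A(2)[of x] by (auto simp: p_def q_def)
    \<comment> \<open>The ratio at the larger value \<open>p\<close>. The line through the origin of
      slope \<open>g\<close> lies below \<open>f x\<close> at \<open>q\<close> and meets it at
      \<open>p\<close>, so \<open>s - f x s\<close> grows by at least
      \<open>(p - q) * (1 - g)\<close> from \<open>q\<close> to \<open>p\<close>.\<close>
    define g where "g = f x p / p"
    have "g < f x q / q" unfolding g_def by (rule kpp_ratio_less[OF f pq(1,2)])
    then have fq: "q * g \<le> f x q" using pq(1) by (simp add: field_simps)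
    have fp: "f x p = p * g" using pq by (simp add: g_def)
    have "p * (1 - g) = (J \<star> u) x" using eqn[of x] fp by (simp add: p_def[symmetric] algebra_simps)
    then have "c \<le> p * (1 - g)" using c(2)[of x] by simp
    moreover have "0 \<le> 1 - g"
      using calculation c(1) pq by (smt (verit) mult_pos_neg)
    \<comment> \<open>The growth rate \<open>1 - g\<close> is bounded away from 0, uniformly in
      \<open>x\<close> and \<open>y\<close>.\<close>
    ultimately have "c \<le> A * (1 - g)" using mult_right_mono[OF pq(3)] by fastforce
    then have "(p - q) * c \<le> (p - q) * (A * (1 - g))" using pq by (intro mult_left_mono) auto
    also have "\<dots> = A * ((p - q) * (1 - g))" by (simp add: mult_ac)
    also have "\<dots> \<le> A * ((Lv + Lf) * dist x y)"
    proof (rule mult_left_mono)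
      have "(p - q) * (1 - g) \<le> p - q - f x p + f x q"
        using fq fp by (simp add: algebra_simps)
      also have "\<dots> = ((J \<star> u) x - (J \<star> u) y) + (f x q - f y q)"
        using eqn[of x] eqn[of y] by (simp add: p_def q_def)
      also have "\<dots> \<le> Lv * dist x y + Lf * dist x y"
      proof (rule add_mono)
        show "(J \<star> u) x - (J \<star> u) y \<le> Lv * dist x y"
          using lipschitz_onD[OF Lv, of x y] by (simp add: dist_real_def)
        show "f x q - f y q \<le> Lf * dist x y"
          using Lf(2)[OF d, of q q] pq by simp
      qed
      finally show "(p - q) * (1 - g) \<le> (Lv + Lf) * dist x y" by (simp add: distrib_right)
    qed (use A in simp)
    finally have "(p - q) * c \<le> A * ((Lv + Lf) * dist x y)" .
    then show ?thesis using c(1) by (simp add: L_def p_def q_def field_simps)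
  qed
  have "(L + 2 * A)-lipschitz_on UNIV u"
  proof (rule lipschitz_onI_local[OF A(2) Lnn])
    fix x y :: "real^'n" assume "dist x y \<le> 1"
    then show "\<bar>u x - u y\<bar> \<le> L * dist x y"
      using le[of x y] le[of y x] by (simp add: dist_commute)
  qed
  then show ?thesis by blast
qed

text \<open>\<open>J \<star> u\<close> is continuous, periodic and positive, so it has the positive
  lower bound \<open>c\<close> required above, even before \<open>u\<close> is known to be
  continuous.\<close>

lemma pos_stationary_solution_lipschitz:
  fixes J :: "real^'n \<Rightarrow> real"
  assumes J: "dispersal_kernel J" and f: "kpp_nonlinearity f"
    and u: "u \<in> pos_bounded_periodic" and sol: "stationary_solution J f u"
  shows "\<exists>L. L-lipschitz_on UNIV u"
proof -
  have u: "u \<in> borel_measurable lebesgue" "bounded (range u)" "periodic u" "\<And>x. 0 < u x"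
    using u by (auto simp: pos_bounded_periodic_def)
  obtain c where "0 < c" "\<And>x. c \<le> (J \<star> u) x"
    using C_per_pos_lower_bound[OF conv_C_per[OF J u(1-3)] conv_pos[OF J u(1,2,4)]] by blast
  then show ?thesis
    using stationary_solution_lipschitz[OF J f u(1,2) less_imp_le[OF u(4)] sol] by blast
qed

lemma C_per_pos_imp_pos_bounded_periodic:
  "u \<in> C_per \<Longrightarrow> (\<And>x. 0 < u x) \<Longrightarrow> u \<in> pos_bounded_periodic"
  using C_per_bounded_range C_per_measurable by (auto simp: pos_bounded_periodic_def C_per_def)

lemma pos_stationary_solution_C_per:
  fixes J :: "real^'n \<Rightarrow> real"
  assumes J: "dispersal_kernel J" and f: "kpp_nonlinearity f"
    and u: "u \<in> pos_bounded_periodic" and sol: "stationary_solution J f u"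
  shows "u \<in> C_per"
  using pos_stationary_solution_lipschitz[OF assms] u lipschitz_on_continuous_on
  unfolding C_per_def pos_bounded_periodic_def by blast

text \<open>Compares \<open>u\<close> with the smallest multiple of \<open>v\<close> lying above it, at a point of contact.\<close>
lemma stationary_solution_le:
  fixes J :: "real^'n \<Rightarrow> real"
  assumes J: "dispersal_kernel J" and f: "kpp_nonlinearity f"
    and u: "u \<in> C_per" "\<And>x. 0 < u x" "stationary_solution J f u"
    and v: "v \<in> C_per" "\<And>x. 0 < v x" "stationary_solution J f v"
  shows "u x \<le> v x"
proof -
  have "(\<lambda>x. v x / u x) \<in> C_per"
    by (intro C_per_divide v(1) u(1)) (use u(2) less_irrefl in metis)
  then obtain y where y: "\<And>x. v y / u y \<le> v x / u x"
    by (rule C_per_attains_inf) blast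
  define t where "t = u y / v y"
  have t: "u x \<le> t * v x" for x
    using y[of x] u(2)[of x] u(2)[of y] v(2)[of y] by (simp add: t_def field_simps)
  have ty: "u y = t * v y" using v(2)[of y] by (simp add: t_def)
  have "0 < t" using u(2) v(2) by (simp add: t_def)
  \<comment> \<open>If \<open>t > 1\<close>, the equations at the contact point force
    \<open>t * f y (v y) \<le> f y (t * v y)\<close>, against the strict decrease of the
    ratio.\<close>
  have "t \<le> 1"
  proof (rule ccontr)
    assume "\<not> t \<le> 1"
    have tv: "(\<lambda>x. t * v x) \<in> C_per"
      by (intro C_per_cmult v(1))
    have "(J \<star> u) y \<le> (J \<star> (\<lambda>x. t * v x)) y"
      by (intro conv_mono J C_per_measurable C_per_bounded_range u(1) tv t)
    moreover have "(J \<star> u) y = u y - f y (u y)" "(J \<star> v) y = v y - f y (v y)"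
      using u(3) v(3) unfolding stationary_solution_def by (simp_all add: algebra_simps)
    ultimately have le: "t * f y (v y) \<le> f y (t * v y)"
      by (simp add: conv_cmult ty algebra_simps)
    have "f y (t * v y) / (t * v y) < f y (v y) / v y"
      by (rule kpp_ratio_less[OF f]) (use v(2)[of y] \<open>\<not> t \<le> 1\<close> in auto)
    then have "f y (t * v y) < t * f y (v y)"
      using v(2)[of y] \<open>0 < t\<close> by (simp add: field_simps)
    with le show False by linarith
  qed
  then have "t * v x \<le> v x" using v(2)[of x] by (simp add: mult_left_le_one_le)
  then show ?thesis using t[of x] by linarith
qed

subsection \<open>The generalized principal eigenvalue\<close>

definition supersolution_exponents :: "(real^'n \<Rightarrow> real) \<Rightarrow> (real^'n \<Rightarrow> real \<Rightarrow> real) \<Rightarrow> real set" where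
  "supersolution_exponents J f = {\<mu>. \<exists>\<phi>\<in>C_per. (\<forall>x. 0 < \<phi> x) \<and>
     (\<forall>x. (J \<star> \<phi>) x - \<phi> x + f_u f x 0 * \<phi> x + \<mu> * \<phi> x \<le> 0)}"

lemma mu0_eq_Sup: "mu0 J f = Sup (supersolution_exponents J f)"
  unfolding mu0_def supersolution_exponents_def ..

text \<open>Dropping the nonnegative convolution term at the single point 0 already bounds
  \<open>\<mu>\<close>. With nonemptiness, this makes \<open>Sup\<close> a genuine supremum.\<close>

lemma bdd_above_supersolution_exponents:
  fixes J :: "real^'n \<Rightarrow> real"
  assumes J: "dispersal_kernel J"
  shows "bdd_above (supersolution_exponents J f)"
proof (rule bdd_aboveI)
  fix \<mu> assume "\<mu> \<in> supersolution_exponents J f"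
  then obtain \<phi> where \<phi>: "\<And>x. 0 < \<phi> x"
      "\<And>x. (J \<star> \<phi>) x - \<phi> x + f_u f x 0 * \<phi> x + \<mu> * \<phi> x \<le> 0"
    unfolding supersolution_exponents_def by auto
  have "0 \<le> (J \<star> \<phi>) 0" by (intro conv_nonneg J less_imp_le \<phi>(1))
  then have "\<mu> * \<phi> 0 \<le> (1 - f_u f 0 0) * \<phi> 0" using \<phi>(2)[of 0] by (simp add: algebra_simps)
  then show "\<mu> \<le> 1 - f_u f 0 0" using \<phi>(1)[of 0] by simp
qed

text \<open>The constant 1 is a test function, since convolution with \<open>J\<close> fixes
  constants.\<close>

lemma supersolution_exponents_nonempty:
  fixes J :: "real^'n \<Rightarrow> real"
  assumes J: "dispersal_kernel J" and f: "kpp_nonlinearity f"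
  shows "supersolution_exponents J f \<noteq> {}"
proof -
  obtain B where B: "\<And>x. \<bar>f_u f x 0\<bar> \<le> B"
    using C_per_bounded[OF kpp_f_u_C_per[OF f]] by blast
  have "f_u f x 0 + - B \<le> 0" for x using B[of x] by linarith
  then have "- B \<in> supersolution_exponents J f"
    unfolding supersolution_exponents_def
    by (intro CollectI bexI[of _ "\<lambda>_. 1"]) (auto simp: conv_const[OF J] C_per_def periodic_def)
  then show ?thesis by blast
qed

text \<open>The gap between \<open>f_u(x,0)\<close> and \<open>f(x,p)/p\<close> makes \<open>p\<close> a strict subsolution of the linearized
  problem; it is compared with a supersolution \<open>\<phi>\<close> at a minimum point of \<open>\<phi> / p\<close>.\<close>
lemma mu0_neg_if_solution:
  fixes J :: "real^'n \<Rightarrow> real"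
  assumes J: "dispersal_kernel J" and f: "kpp_nonlinearity f"
    and p: "p \<in> C_per" "\<And>x. 0 < p x" "stationary_solution J f p"
  shows "mu0 J f < 0"
proof -
  let ?a = "\<lambda>x. f_u f x 0"
  have pne: "p x \<noteq> 0" for x using p(2)[of x] by simp
  have "(\<lambda>x. ?a x - f x (p x) / p x) \<in> C_per"
    by (rule C_per_diff[OF kpp_f_u_C_per[OF f]
          C_per_divide[OF kpp_comp_C_per[OF f p(1) less_imp_le[OF p(2)]] p(1) pne]])
  then obtain \<delta> where \<delta>: "0 < \<delta>" "\<And>x. \<delta> \<le> ?a x - f x (p x) / p x"
    by (rule C_per_pos_lower_bound) (simp add: kpp_ratio_less_f_u[OF f p(2)], blast)
  have "\<mu> \<le> - \<delta>" if \<mu>: "\<mu> \<in> supersolution_exponents J f" for \<mu>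
  proof -
    obtain \<phi> where \<phi>: "\<phi> \<in> C_per" "\<And>x. 0 < \<phi> x"
        "\<And>x. (J \<star> \<phi>) x - \<phi> x + ?a x * \<phi> x + \<mu> * \<phi> x \<le> 0"
      using \<mu> unfolding supersolution_exponents_def by blast
    have "(\<lambda>x. \<phi> x / p x) \<in> C_per"
      by (intro C_per_divide \<phi>(1) p(1) pne)
    then obtain y where y: "\<And>x. \<phi> y / p y \<le> \<phi> x / p x"
      by (rule C_per_attains_inf) blast
    \<comment> \<open>The largest multiple of \<open>p\<close> below \<open>\<phi>\<close>, touching
      it at \<open>y\<close>; the convolutions are then ordered while the values at \<open>y\<close>
      agree.\<close>
    define t where "t = \<phi> y / p y"
    have t: "t * p x \<le> \<phi> x" for x using y[of x] p(2)[of x] by (simp add: t_def[symmetric] field_simps)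
    have ty: "\<phi> y = t * p y" using pne[of y] by (simp add: t_def)
    have "0 < t" using \<phi>(2) p(2) by (simp add: t_def)
    have tp: "(\<lambda>x. t * p x) \<in> C_per"
      by (intro C_per_cmult p(1))
    have "(J \<star> (\<lambda>x. t * p x)) y \<le> (J \<star> \<phi>) y"
      by (intro conv_mono J C_per_measurable C_per_bounded_range \<phi>(1) tp t)
    moreover have "(J \<star> p) y = p y - f y (p y)"
      using p(3) unfolding stationary_solution_def by (simp add: algebra_simps)
    moreover have "f y (p y) \<le> (?a y - \<delta>) * p y"
      using \<delta>(2)[of y] p(2)[of y] by (simp add: field_simps)
    then have "t * f y (p y) \<le> t * ((?a y - \<delta>) * p y)"
      using \<open>0 < t\<close> by (intro mult_left_mono) auto
    ultimately have "\<delta> * \<phi> y + \<mu> * \<phi> y \<le> 0"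
      using \<phi>(3)[of y] by (simp add: conv_cmult ty algebra_simps)
    then have "(\<delta> + \<mu>) * \<phi> y \<le> 0" by (simp add: distrib_right)
    then show ?thesis using \<phi>(2)[of y] by (simp add: mult_le_0_iff)
  qed
  then have "mu0 J f \<le> - \<delta>"
    unfolding mu0_eq_Sup by (intro cSup_least supersolution_exponents_nonempty J f)
  with \<delta>(1) show ?thesis by simp
qed

subsection \<open>The maximal solution\<close>

text \<open>Monotone iteration from the constant supersolution \<open>M\<close>.  All iterates are positive
  supersolutions, and they stay above every constant \<open>\<epsilon>\<close> at the points where
  \<open>\<epsilon> \<le> f(x, \<epsilon>)\<close>; the second fact excludes a limit vanishing only almost everywhere.\<close>
lemma monotone_iteration:
  fixes J :: "real^'n \<Rightarrow> real"
  assumes J: "dispersal_kernel J" and f: "kpp_nonlinearity f"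
    and M: "0 < M" "\<And>x. f x M \<le> 0"
  shows "\<exists>U :: nat \<Rightarrow> real^'n \<Rightarrow> real. (\<forall>n. U n \<in> C_per) \<and>
    (\<forall>n x. 0 < U n x \<and> U n x \<le> M \<and> U (Suc n) x \<le> U n x) \<and>
    (\<forall>n x. (J \<star> U n) x - U n x + f x (U n x) \<le> 0) \<and>
    (\<forall>x. (\<lambda>n. (J \<star> U n) x - U n x + f x (U n x)) \<longlonglongrightarrow> 0) \<and>
    (\<forall>n x \<epsilon>. 0 \<le> \<epsilon> \<longrightarrow> \<epsilon> \<le> M \<longrightarrow> \<epsilon> \<le> f x \<epsilon> \<longrightarrow> \<epsilon> \<le> U n x)"
proof -
  obtain L where L: "0 \<le> L" "\<And>x y s t. \<lbrakk>dist x y \<le> 1; s \<in> {0..M}; t \<in> {0..M}\<rbrakk> \<Longrightarrow>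
      \<bar>f x s - f y t\<bar> \<le> L * (dist x y + \<bar>s - t\<bar>)"
    using kpp_lipschitz[OF f, of M] by metis
  \<comment> \<open>With this shift, \<open>(K - 1) * s + f x s\<close> increases on
    \<open>[0, M]\<close> at rate at least 1: enough for \<open>T\<close> to be monotone and to
    preserve strict positivity.\<close>
  define K where "K = L + 2"
  have K: "0 < K" using L(1) by (simp add: K_def)
  have inc: "(K - 1) * s + f x s + (t - s) \<le> (K - 1) * t + f x t"
    if "0 \<le> s" "s \<le> t" "t \<le> M" for x s t
    using L(2)[of x x s t] that by (simp add: K_def algebra_simps)
  define T where "T u x = ((J \<star> u) x + (K - 1) * u x + f x (u x)) / K" for u x
  define U where "U n = (T ^^ n) (\<lambda>_. M)" for n
  have U0: "U 0 x = M" and US: "U (Suc n) = T (U n)" for x n by (simp_all add: U_def)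
  have KT: "K * T u x = (J \<star> u) x + (K - 1) * u x + f x (u x)" for u x
    using K by (simp add: T_def)
  have T_mono: "T u x \<le> T v x"
    if "u \<in> C_per" "v \<in> C_per" "\<And>x. 0 \<le> u x" "\<And>x. u x \<le> v x" "\<And>x. v x \<le> M" for u v x
  proof -
    have "(J \<star> u) x \<le> (J \<star> v) x"
      by (intro conv_mono J C_per_measurable C_per_bounded_range that)
    then have "K * T u x \<le> K * T v x"
      unfolding KT using inc[of "u x" "v x" x] that(3)[of x] that(4)[of x] that(5)[of x] by linarith
    then show ?thesis using K by simp
  qed
  have T_C_per: "T u \<in> C_per" if "u \<in> C_per" "\<And>x. 0 \<le> u x" for u
  proof -
    have "J \<star> u \<in> C_per"
      using that(1) by (intro conv_C_per J C_per_measurable C_per_bounded_range) (auto simp: C_per_def)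
    then show ?thesis
      using that(1) kpp_comp_C_per[OF f that] K
      unfolding T_def C_per_def periodic_def by (auto intro!: continuous_intros)
  qed
  have T_pos: "0 < T u x" if "\<And>x. 0 < u x" "u x \<le> M" for u x
  proof -
    have "0 \<le> (J \<star> u) x" by (intro conv_nonneg J less_imp_le that)
    then have "0 < K * T u x"
      unfolding KT using inc[of 0 "u x" x] that(1)[of x] that(2) kpp_zero[OF f, of x] by auto
    then show ?thesis using K by (simp add: zero_less_mult_iff)
  qed
  have main: "U n \<in> C_per \<and> (\<forall>x. 0 < U n x \<and> U n x \<le> M \<and> U (Suc n) x \<le> U n x)" for n
  proof (induction n)
    case 0
    have "T (\<lambda>_. M) x \<le> M" for x
    proof -
      have "K * T (\<lambda>_. M) x \<le> K * M"
        unfolding KT conv_const[OF J] using M(2)[of x] by (simp add: algebra_simps)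
      then show ?thesis using K by simp
    qed
    then show ?case using M(1) by (simp add: U_def C_per_def periodic_def)
  next
    case (Suc n)
    have "U (Suc n) \<in> C_per" using Suc T_C_per by (simp add: US less_imp_le)
    moreover have "0 < U (Suc n) x" for x using Suc T_pos by (simp add: US)
    moreover have "U (Suc n) x \<le> M" for x using Suc order_trans by blast
    ultimately show ?case
      using T_mono[of "U (Suc n)" "U n"] Suc US[of "Suc n"] US[of n] by (auto simp: less_imp_le)
  qed
  \<comment> \<open>The defect in the equation is \<open>K\<close> times the increment of the
    iteration, so it inherits the sign of the increment and tends to 0 once the iterates
    converge.\<close>
  have eq: "(J \<star> U n) x - U n x + f x (U n x) = K * (U (Suc n) x - U n x)" for n x
    unfolding US right_diff_distrib KT by (simp add: algebra_simps)
  show ?thesis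
  proof (intro exI[of _ U] conjI allI impI)
    show "(J \<star> U n) x - U n x + f x (U n x) \<le> 0" for n x
      unfolding eq using main[of n] K by (auto simp: mult_le_0_iff)
    show "(\<lambda>n. (J \<star> U n) x - U n x + f x (U n x)) \<longlonglongrightarrow> 0" for x
    proof -
      have "decseq (\<lambda>n. U n x)" using main by (simp add: decseq_Suc_iff)
      then obtain l where l: "(\<lambda>n. U n x) \<longlonglongrightarrow> l"
        using decseq_convergent[of "\<lambda>n. U n x" 0] main less_imp_le by metis
      have "(\<lambda>n. K * (U (Suc n) x - U n x)) \<longlonglongrightarrow> K * (l - l)"
        using l LIMSEQ_Suc[OF l] by (intro tendsto_intros)
      then show ?thesis unfolding eq by simp
    qed
    \<comment> \<open>Only the nonnegativity of the convolution enters, so the bound holds at each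
      point \<open>x\<close> separately.\<close>
    show "\<epsilon> \<le> U n x" if "0 \<le> \<epsilon>" "\<epsilon> \<le> M" "\<epsilon> \<le> f x \<epsilon>" for n x \<epsilon>
    proof (induction n)
      case (Suc n)
      have "0 \<le> (J \<star> U n) x" by (intro conv_nonneg J) (use main less_imp_le in blast)
      then have "K * \<epsilon> \<le> K * U (Suc n) x"
        unfolding US KT using inc[of \<epsilon> "U n x" x] Suc that main[of n] by (simp add: algebra_simps) 
      then show ?case using K by simp
    qed (simp add: U0 that)
  qed (use main in auto)
qed

section \<open>Passage to the limit and the strong maximum principle\<close>

lemma conv_tendsto:
  fixes J :: "real^'n \<Rightarrow> real"
  assumes J: "dispersal_kernel J" and U: "\<And>n. U n \<in> borel_measurable lebesgue" "\<And>n y. \<bar>U n y\<bar> \<le> M"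
    and w: "w \<in> borel_measurable lebesgue" and lim: "\<And>y. (\<lambda>n. U n y) \<longlonglongrightarrow> w y"
  shows "(\<lambda>n. (J \<star> U n) x) \<longlonglongrightarrow> (J \<star> w) x"
  unfolding conv_def
proof (rule integral_dominated_convergence)
  show "integrable lebesgue (\<lambda>y. J (x - y) * M)"
    by (rule conv_integrable[OF J]) auto
  show "AE y in lebesgue. norm (J (x - y) * U n y) \<le> J (x - y) * M" for n
    using U(2) kernel_nonneg[OF J] by (auto simp: abs_mult intro!: AE_I2 mult_left_mono)
  show "AE y in lebesgue. (\<lambda>n. J (x - y) * U n y) \<longlonglongrightarrow> J (x - y) * w y"
    by (intro AE_I2 tendsto_intros lim)
qed (intro borel_measurable_times kernel_shift_measurable[OF J] U(1) w)+

text \<open>The zero set of \<open>J \<star> w\<close> is closed by continuity. Around a zero,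
  \<open>w\<close> vanishes almost everywhere on a ball; by the last hypothesis the points of that
  ball with \<open>J \<star> w\<close> nonzero form an open null set, hence none exist.
  Connectedness of the space finishes.\<close>

lemma conv_eq_0_all_or_none:
  fixes J :: "real^'n \<Rightarrow> real"
  assumes J: "dispersal_kernel J"
    and w: "w \<in> borel_measurable lebesgue" "bounded (range w)" "\<And>y. 0 \<le> w y"
    and z: "\<And>y. w y = 0 \<Longrightarrow> (J \<star> w) y = 0"
  shows "(\<forall>x. (J \<star> w) x = 0) \<or> (\<forall>x. 0 < (J \<star> w) x)"
proof -
  obtain r where r: "0 < r" "\<And>z. norm z < r \<Longrightarrow> 0 < J z" using kernel_pos_near_zero[OF J] by blast
  obtain L where "L-lipschitz_on UNIV (J \<star> w)" using conv_lipschitz[OF J w(1,2)] by blast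
  then have cont: "continuous_on UNIV (J \<star> w)" by (rule lipschitz_on_continuous_on)
  let ?Z = "{x. (J \<star> w) x = 0}"
  have "closed ?Z" using cont by (intro closed_Collect_eq continuous_on_const)
  moreover have "open ?Z"
    unfolding open_contains_ball
  proof
    fix x assume "x \<in> ?Z"
    then have "(J \<star> w) x = 0" by simp
    with J r(2) w have neg: "negligible {y \<in> ball x r. w y \<noteq> 0}" by (rule conv_eq_0_imp)
    let ?S = "ball x r \<inter> {y. (J \<star> w) y \<noteq> 0}"
    have "?S \<subseteq> {y \<in> ball x r. w y \<noteq> 0}" using z by blast
    with neg have "negligible ?S" by (rule negligible_subset)
    moreover have "open ?S" using cont by (intro open_Int open_ball open_Collect_neq continuous_on_const)
    ultimately have "?S = {}" using open_not_negligible[of ?S] by blast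
    then have "ball x r \<subseteq> ?Z" by blast
    then show "\<exists>e>0. ball x e \<subseteq> ?Z" using r(1) by blast
  qed
  ultimately have "?Z = {} \<or> ?Z = UNIV" using clopen[of ?Z] by blast
  then show ?thesis
  proof
    assume "?Z = {}"
    then have "(J \<star> w) x \<noteq> 0" for x by blast
    moreover have "0 \<le> (J \<star> w) x" for x by (intro conv_nonneg J w(3))
    ultimately show ?thesis by (simp add: order_less_le)
  qed blast
qed

lemma solution_exists_if_mu0_neg:
  fixes J :: "real^'n \<Rightarrow> real"
  assumes J: "dispersal_kernel J" and f: "kpp_nonlinearity f" and mu0: "mu0 J f < 0"
  shows "\<exists>p\<in>C_per. (\<forall>x. 0 < p x) \<and> stationary_solution J f p"
proof -
  obtain M where M: "0 < M" "\<And>x. f x M \<le> 0" using kpp_threshold[OF f] by blast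
  obtain U where U': "\<forall>n. U n \<in> C_per"
      "\<forall>n x. 0 < U n x \<and> U n x \<le> M \<and> U (Suc n) x \<le> U n x"
      "\<forall>n x. (J \<star> U n) x - U n x + f x (U n x) \<le> 0"
      "\<forall>x. (\<lambda>n. (J \<star> U n) x - U n x + f x (U n x)) \<longlonglongrightarrow> 0"
      "\<forall>n x \<epsilon>. 0 \<le> \<epsilon> \<longrightarrow> \<epsilon> \<le> M \<longrightarrow> \<epsilon> \<le> f x \<epsilon> \<longrightarrow> \<epsilon> \<le> U n x"
    using monotone_iteration[OF J f M] by (elim exE conjE)
  have UC: "U n \<in> C_per" for n using U'(1) ..
  have U: "0 < U n x" "U n x \<le> M" and dec: "U (Suc n) x \<le> U n x" for n x
    using U'(2) by simp_all
  have super: "(J \<star> U n) x - U n x + f x (U n x) \<le> 0" for n x using U'(3) by simp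
  have defect: "(\<lambda>n. (J \<star> U n) x - U n x + f x (U n x)) \<longlonglongrightarrow> 0" for x using U'(4) ..
  have floor: "\<epsilon> \<le> U n x" if "0 \<le> \<epsilon>" "\<epsilon> \<le> M" "\<epsilon> \<le> f x \<epsilon>" for n x \<epsilon>
    using U'(5) that by simp
  have Uabs: "\<bar>U n x\<bar> \<le> M" for n x using U(1)[of n x] U(2)[of n x] by simp
  have "\<exists>l. (\<lambda>n. U n x) \<longlonglongrightarrow> l" for x
  proof -
    have "decseq (\<lambda>n. U n x)" using dec by (simp add: decseq_Suc_iff)
    moreover have "\<forall>i. 0 \<le> U i x" using U(1) less_imp_le by blast
    ultimately obtain l where "(\<lambda>n. U n x) \<longlonglongrightarrow> l" "\<forall>i. l \<le> U i x"
      by (rule decseq_convergent)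
    then show ?thesis by blast
  qed
  then have "\<exists>w. \<forall>x. (\<lambda>n. U n x) \<longlonglongrightarrow> w x" by (intro choice allI)
  then obtain w where w: "\<And>x. (\<lambda>n. U n x) \<longlonglongrightarrow> w x" by blast
  have w_ge: "\<epsilon> \<le> w x" if "\<And>n. \<epsilon> \<le> U n x" for x \<epsilon>
    using that by (intro LIMSEQ_le_const[OF w]) auto
  have w_nonneg: "0 \<le> w x" for x by (intro w_ge less_imp_le U(1))
  have w_le: "w x \<le> M" for x using U(2) by (intro LIMSEQ_le_const2[OF w]) auto
  have w_meas: "w \<in> borel_measurable lebesgue"
    by (rule borel_measurable_LIMSEQ_real[OF w C_per_measurable[OF UC]])
  have w_bdd: "bounded (range w)"
    unfolding bounded_iff by (rule exI[of _ M]) (use w_nonneg w_le in auto)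
  have w_per: "periodic w"
    unfolding periodic_def
  proof (intro allI impI)
    fix x k :: "real^'n" assume "\<forall>i. k $ i \<in> \<int>"
    then have "(\<lambda>n. U n (x + k)) = (\<lambda>n. U n x)" using UC by (auto simp: C_per_def periodic_def)
    then show "w (x + k) = w x" using w[of "x + k"] w[of x] LIMSEQ_unique by metis
  qed
  have f_lim: "(\<lambda>n. f x (U n x)) \<longlonglongrightarrow> f x (w x)" for x
  proof -
    have "continuous_on {0..} (\<lambda>u. (\<lambda>(x, u). f x u) (x, u))"
      by (rule continuous_on_compose2[OF Ck_on_imp_continuous_on[OF kpp_Ck[OF f]]])
        (auto intro!: continuous_intros)
    then have "continuous_on {0..} (f x)" by simp
    then show ?thesis
      using continuous_on_tendsto_compose[OF _ w, of "{0..}" "f x" x] w_nonneg U(1)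
      by (simp add: less_imp_le)
  qed
  have w_sol: "(J \<star> w) x - w x + f x (w x) = 0" for x
  proof (rule LIMSEQ_unique[OF _ defect[of x]])
    show "(\<lambda>n. (J \<star> U n) x - U n x + f x (U n x)) \<longlonglongrightarrow> (J \<star> w) x - w x + f x (w x)"
      by (intro tendsto_intros w f_lim conv_tendsto[OF J C_per_measurable[OF UC] Uabs w_meas w])
  qed
  have "(\<forall>x. (J \<star> w) x = 0) \<or> (\<forall>x. 0 < (J \<star> w) x)"
  proof (rule conv_eq_0_all_or_none[OF J w_meas w_bdd w_nonneg])
    show "(J \<star> w) y = 0" if "w y = 0" for y
      using w_sol[of y] kpp_zero[OF f, of y] that by simp
  qed
  then show ?thesis
  proof
    assume pos: "\<forall>x. 0 < (J \<star> w) x"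
    obtain c where c: "0 < c" "\<And>x. c \<le> (J \<star> w) x"
      using C_per_pos_lower_bound[OF conv_C_per[OF J w_meas w_bdd w_per]] pos by blast
    have sol: "stationary_solution J f w" using w_sol by (simp add: stationary_solution_def)
    then obtain L where "L-lipschitz_on UNIV w"
      using stationary_solution_lipschitz[OF J f w_meas w_bdd w_nonneg sol c] by blast
    then have "w \<in> C_per" using w_per lipschitz_on_continuous_on by (auto simp: C_per_def)
    moreover have "0 < w x" for x
      using w_nonneg[of x] pos[rule_format, of x] w_sol[of x] kpp_zero[OF f, of x]
      by (cases "w x = 0") auto
    ultimately show ?thesis using sol by blast
  next
    assume zero: "\<forall>x. (J \<star> w) x = 0"
    \<comment> \<open>So far \<open>w\<close> vanishes only almost everywhere. If the derivative
      exceeded 1, some \<epsilon> would satisfy \<open>\<epsilon> < f y \<epsilon>\<close> on an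
      open set around \<open>x\<close>, and \<open>floor\<close> would keep \<open>w\<close> above
      \<epsilon> there.\<close>
    have a_le: "f_u f x 0 \<le> 1" for x
    proof (rule ccontr)
      assume "\<not> f_u f x 0 \<le> 1"
      then have "eventually (\<lambda>s. 1 < f x s / s) (at_right 0)"
        by (intro order_tendstoD(1)[OF kpp_ratio_tendsto[OF f]]) simp
      moreover have "eventually (\<lambda>s. 0 < s \<and> s < M) (at_right 0)"
        unfolding eventually_at_right_field using M(1) by auto
      ultimately have "eventually (\<lambda>s. 1 < f x s / s \<and> 0 < s \<and> s < M) (at_right 0)"
        by (rule eventually_conj)
      then obtain \<epsilon> where \<epsilon>: "1 < f x \<epsilon> / \<epsilon>" "0 < \<epsilon>" "\<epsilon> < M"
        using eventually_happens'[OF trivial_limit_at_right_real] by blast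
      have "(\<lambda>y. f y \<epsilon>) \<in> C_per"
        using kpp_comp_C_per[OF f, of "\<lambda>_. \<epsilon>"] \<epsilon> by (simp add: C_per_def periodic_def)
      then have op: "open {y. \<epsilon> < f y \<epsilon>}"
        by (intro open_Collect_less) (auto simp: C_per_def)
      obtain r where r: "0 < r" "\<And>z. norm z < r \<Longrightarrow> 0 < J z" using kernel_pos_near_zero[OF J] by blast
      have neg: "negligible {y \<in> ball x r. w y \<noteq> 0}"
        using conv_eq_0_imp[OF J r(2) w_meas w_bdd w_nonneg] zero by blast
      have "\<epsilon> \<le> w y" if "\<epsilon> < f y \<epsilon>" for y
        using \<epsilon> that by (intro w_ge floor) auto
      then have "ball x r \<inter> {y. \<epsilon> < f y \<epsilon>} \<subseteq> {y \<in> ball x r. w y \<noteq> 0}" using \<epsilon>(2) by force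
      then have "negligible (ball x r \<inter> {y. \<epsilon> < f y \<epsilon>})" using neg negligible_subset by blast
      then have "ball x r \<inter> {y. \<epsilon> < f y \<epsilon>} = {}"
        using op open_not_negligible by (metis open_Int open_ball)
      moreover have "x \<in> ball x r \<inter> {y. \<epsilon> < f y \<epsilon>}" using r(1) \<epsilon> by (simp add: field_simps)
      ultimately show False by blast
    qed
    \<comment> \<open>A positive value would satisfy \<open>f x (w x) / w x = 1\<close>, although
      this ratio lies strictly below \<open>f_u f x 0\<close>, which is at most 1.\<close>
    have w0: "w x = 0" for x
    proof (rule ccontr)
      assume "w x \<noteq> 0"
      then have "0 < w x" using w_nonneg[of x] by simp
      moreover have "f x (w x) = w x" using w_sol[of x] zero by simp
      ultimately show False
        using kpp_ratio_less_f_u[OF f, of "w x" x] a_le[of x] by simp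
    qed
    let ?h = "\<lambda>n x. f_u f x 0 - f x (U n x) / U n x"
    have fU: "(\<lambda>x. f x (U n x)) \<in> C_per" for n
      by (rule kpp_comp_C_per[OF f UC less_imp_le[OF U(1)]])
    have h_C_per: "?h n \<in> C_per" for n
    proof -
      have "U n x \<noteq> 0" for x using U(1)[of n x] by simp
      then show ?thesis
        by (rule C_per_diff[OF kpp_f_u_C_per[OF f] C_per_divide[OF fU UC]])
    qed
    have h_dec: "?h (Suc n) x \<le> ?h n x" for n x
      using dec[of n x] kpp_ratio_less[OF f U(1)[of "Suc n" x], of "U n x" x]
      by (cases "U (Suc n) x = U n x") auto
    have h_lim: "(\<lambda>n. ?h n x) \<longlonglongrightarrow> 0" for x
    proof -
      have "filterlim (\<lambda>n. U n x) (at_right 0) sequentially"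
        using w[of x] U(1) less_imp_neq[OF U(1), of _ x]
        by (auto simp: w0 filterlim_at intro!: always_eventually)
      then have "(\<lambda>n. f x (U n x) / U n x) \<longlonglongrightarrow> f_u f x 0"
        using filterlim_compose[OF kpp_ratio_tendsto[OF f]] by blast
      then show ?thesis using tendsto_diff[OF tendsto_const, of _ "f_u f x 0" _ "f_u f x 0"] by simp
    qed
    have "0 < - mu0 J f / 2" using mu0 by simp
    from C_per_decreasing_null_sequence[of ?h, OF h_C_per h_dec h_lim this]
    obtain n where n: "\<And>x. ?h n x < - mu0 J f / 2" by blast
    \<comment> \<open>Half of a negative number is larger, so this exponent exceeds the supremum.
      The nonlinear supersolution \<open>U n\<close> serves as test function because its ratio is
      uniformly within \<open>- mu0 J f / 2\<close> of the derivative at 0.\<close>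
    have "mu0 J f / 2 \<in> supersolution_exponents J f"
      unfolding supersolution_exponents_def
    proof (intro CollectI bexI[OF _ UC[of n]] conjI allI U(1))
      fix x
      have "(f_u f x 0 + mu0 J f / 2) * U n x \<le> f x (U n x) / U n x * U n x"
        using n[of x] U(1)[of n x] by (intro mult_right_mono) auto
      then have "(f_u f x 0 + mu0 J f / 2) * U n x \<le> f x (U n x)"
        using U(1)[of n x] by simp
      then show "(J \<star> U n) x - U n x + f_u f x 0 * U n x + mu0 J f / 2 * U n x \<le> 0"
        using super[of n x] by (simp add: distrib_right)
    qed
    then have "mu0 J f / 2 \<le> mu0 J f"
      unfolding mu0_eq_Sup by (intro cSup_upper bdd_above_supersolution_exponents J)
    with mu0 show ?thesis by simp
  qed
qed

theorem theorem1p1: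
  fixes J :: "real^'n \<Rightarrow> real" and f :: "real^'n \<Rightarrow> real \<Rightarrow> real"
  assumes "dispersal_kernel J" and "kpp_nonlinearity f"
  shows "((\<exists>p\<in>C_per. (\<forall>x. 0 < p x) \<and> stationary_solution J f p) \<longleftrightarrow> mu0 J f < 0) \<and>
    (\<forall>p\<in>C_per. (\<forall>x. 0 < p x) \<and> stationary_solution J f p \<longrightarrow> (\<exists>L. L-lipschitz_on UNIV p)) \<and>
    (\<forall>u\<in>pos_bounded_periodic. \<forall>v\<in>pos_bounded_periodic.
       stationary_solution J f u \<and> stationary_solution J f v \<longrightarrow> u = v)"
proof (intro conjI iffI ballI impI)
  show "mu0 J f < 0" if "\<exists>p\<in>C_per. (\<forall>x. 0 < p x) \<and> stationary_solution J f p"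
    using that mu0_neg_if_solution[OF assms] by blast
  show "\<exists>p\<in>C_per. (\<forall>x. 0 < p x) \<and> stationary_solution J f p" if "mu0 J f < 0"
    using solution_exists_if_mu0_neg[OF assms that] .
  show "\<exists>L. L-lipschitz_on UNIV p"
    if "p \<in> C_per" "(\<forall>x. 0 < p x) \<and> stationary_solution J f p" for p
    using pos_stationary_solution_lipschitz[OF assms C_per_pos_imp_pos_bounded_periodic] that by blast
  show "u = v"
    if uv: "u \<in> pos_bounded_periodic" "v \<in> pos_bounded_periodic"
      and sol: "stationary_solution J f u \<and> stationary_solution J f v" for u v
  proof -
    \<comment> \<open>Continuity comes first, since the comparison in both directions relies on
      attained extrema.\<close>
    have C: "u \<in> C_per" "v \<in> C_per"
      using pos_stationary_solution_C_per[OF assms] uv sol by auto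
    have pos: "\<And>x. 0 < u x" "\<And>x. 0 < v x"
      using uv by (auto simp: pos_bounded_periodic_def)
    have "u x \<le> v x" "v x \<le> u x" for x
      using sol by (auto intro!: stationary_solution_le[OF assms] C pos)
    then show ?thesis by (intro ext antisym)
  qed
qed

end
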